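(* Let $\lambda\in(0,1]$ and suppose that $f\in\mathcal{U}_2(\lambda)$ has the form $$\frac{z}{f(z)}=1+\lambda\,\omega_1(z),\qquad z\in\mathbb{D},$$ with $\omega_1(z)=az^2$, where $a\in\mathbb{C}$ and $|a|\le 1$. Then $f$ is convex in the direction $\gamma=2\pi-\frac{\arg a}{2}$ (where $\arg a$ is any argument of $a$ if $a\ne0$, and any real number if $a=0$).
   Context: $\mathbb{D}=\{z\in\mathbb{C}:|z|<1\}$. $\mathcal{A}$ is the family of analytic functions $f$ in $\mathbb{D}$ with $f(0)=0=f'(0)-1$. For $0<\lambda\le1$, $\mathcal{U}(\lambda)$ is the set of $f\in\mathcal{A}$ with $\left|\left(\frac{z}{f(z)}\right)^2f'(z)-1\right|<\lambda$ for all $z\in\mathbb{D}$ (in particular $f$ does not vanish in $\mathbb{D}\setminus\{0\}$, and $z/f(z)$ is understood to be $1$ at $z=0$). $\mathcal{U}_2(\lambda)=\{f\in\mathcal{U}(\lambda): f''(0)=0\}$. A domain $D\subset\mathbb{C}$ is convex in the direction $\gamma$ if every line parallel to the line through $0$ and $e^{i\gamma}$ has a connected (possibly empty) intersection with $D$; the condition depends only on $\gamma$ modulo $\pi$. A function $f$ analytic in $\mathbb{D}$ is called convex in the direction $\gamma$ if $f$ is univalent in $\mathbb{D}$ and $f(\mathbb{D})$ is a domain convex in the direction $\gamma$. *)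

theory Defs
  imports "HOL-Complex_Analysis.Complex_Analysis"
begin

text \<open>The open unit disk is \<open>ball 0 1\<close>. Functions on it are total functions on the complex
  numbers, and every condition constrains them on the disk only.\<close>

definition class_A :: "(complex \<Rightarrow> complex) set" where
  "class_A = {f. f holomorphic_on ball 0 1 \<and> f 0 = 0 \<and> deriv f 0 - 1 = 0}"

text \<open>The function \<open>z / f z\<close> with its removable singularity at \<open>0\<close> filled in (for \<open>f\<close> normalised
  by \<open>f 0 = 0\<close> and \<open>deriv f 0 = 1\<close>).\<close>

definition z_over :: "(complex \<Rightarrow> complex) \<Rightarrow> complex \<Rightarrow> complex" where
  "z_over f z = (if z = 0 then 1 else z / f z)"

text \<open>Finiteness of \<open>z / f z\<close> away from \<open>0\<close> is part of the defining inequality of the class; it is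
  spelled out because division is total here. (For \<open>lam \<le> 1\<close> it also follows from the inequality
  under the convention \<open>z / 0 = 0\<close>.)\<close>

definition class_U :: "real \<Rightarrow> (complex \<Rightarrow> complex) set" where
  "class_U lam = {f \<in> class_A.
     (\<forall>z\<in>ball 0 1 - {0}. f z \<noteq> 0) \<and>
     (\<forall>z\<in>ball 0 1. cmod ((z_over f z)\<^sup>2 * deriv f z - 1) < lam)}"

definition class_U2 :: "real \<Rightarrow> (complex \<Rightarrow> complex) set" where
  "class_U2 lam = {f \<in> class_U lam. deriv (deriv f) 0 = 0}"

definition line_in_direction :: "real \<Rightarrow> complex \<Rightarrow> complex set" where
  "line_in_direction \<gamma> p = {p + of_real t * cis \<gamma> | t::real. True}"

definition domain_convex_in_direction :: "real \<Rightarrow> complex set \<Rightarrow> bool" where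
  "domain_convex_in_direction \<gamma> D \<longleftrightarrow>
     open D \<and> connected D \<and> D \<noteq> {} \<and>
     (\<forall>p. connected (D \<inter> line_in_direction \<gamma> p))"

definition convex_in_direction :: "real \<Rightarrow> (complex \<Rightarrow> complex) \<Rightarrow> bool" where
  "convex_in_direction \<gamma> f \<longleftrightarrow>
     f holomorphic_on ball 0 1 \<and> inj_on f (ball 0 1) \<and>
     domain_convex_in_direction \<gamma> (f ` ball 0 1)"

end

theory Submission
  imports Defs
begin

text \<open>After the rotation \<open>w = cis (\<theta> / 2) * z\<close> the function becomes \<open>w / (1 + r * w\<^sup>2)\<close> with
  \<open>r = lam * cmod a\<close>, and the direction becomes the real one. For \<open>r < 1\<close> the reciprocal
  \<open>1 / w + r * w\<close> maps the unit circle onto an ellipse with semi-axes \<open>1 + r\<close> and \<open>1 - r\<close>, so the image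
  of the disk is, away from \<open>0\<close>, the set of all \<open>x + i * y\<close> with
  \<open>x\<^sup>2 / (1 + r)\<^sup>2 + y\<^sup>2 / (1 - r)\<^sup>2 > (x\<^sup>2 + y\<^sup>2)\<^sup>2\<close>. This inequality survives shrinking \<open>\<bar>x\<bar>\<close>, so
  horizontal sections are intervals. The case \<open>r = 1\<close> follows by exhausting the disk by smaller
  disks, on which rescaling makes \<open>r\<close> smaller.\<close>

section \<open>The map \<open>z / (1 + k * z\<^sup>2)\<close>: holomorphy and univalence\<close>

definition joukowski_recip :: "complex \<Rightarrow> complex \<Rightarrow> complex" where
  "joukowski_recip k z = z / (1 + k * z\<^sup>2)"

text \<open>The ellipse inequality with denominators cleared. For \<open>0 \<le> r\<close>,
  \<open>r < 1\<close> and \<open>x + i * y\<close> nonzero, it is positive exactly when the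
  reciprocal of \<open>x + i * y\<close> lies outside the ellipse.\<close>

definition quartic_gap :: "real \<Rightarrow> real \<Rightarrow> real \<Rightarrow> real" where
  "quartic_gap r x y =
     x\<^sup>2 * (1 - r)\<^sup>2 + y\<^sup>2 * (1 + r)\<^sup>2 - (1 + r)\<^sup>2 * (1 - r)\<^sup>2 * (x\<^sup>2 + y\<^sup>2)\<^sup>2"

lemma cmod_mult_square_less_1:
  assumes "cmod k \<le> 1" "cmod z < 1" "cmod w < 1"
  shows "cmod (k * z * w) < 1"
proof -
  have "cmod (k * z * w) \<le> cmod z * cmod w"
    using assms by (simp add: norm_mult mult_left_le_one_le mult.assoc)
  also have "\<dots> < 1"
    using mult_strict_mono[of "cmod z" 1 "cmod w" 1] assms by simp
  finally show ?thesis .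
qed

lemma joukowski_recip_denom_nonzero:
  assumes "cmod k \<le> 1" "cmod z < 1"
  shows "1 + k * z\<^sup>2 \<noteq> 0"
proof
  assume "1 + k * z\<^sup>2 = 0"
  then have "k * z * z = -1"
    by (simp add: power2_eq_square eq_neg_iff_add_eq_0 add.commute mult.assoc)
  with cmod_mult_square_less_1[OF assms(1,2,2)] show False
    by simp
qed

lemma joukowski_recip_holomorphic:
  assumes "cmod k \<le> 1"
  shows "joukowski_recip k holomorphic_on ball 0 1"
  unfolding joukowski_recip_def
  by (intro holomorphic_intros) (use joukowski_recip_denom_nonzero[OF assms] in auto)

text \<open>Cross-multiplying equal values leaves \<open>(z - w) * (1 - k * z * w) = 0\<close>, and
  the second factor cannot vanish on the disk.\<close>

lemma joukowski_recip_inj: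
  assumes "cmod k \<le> 1"
  shows "inj_on (joukowski_recip k) (ball 0 1)"
proof (rule inj_onI)
  fix z w assume z: "z \<in> ball 0 1" and w: "w \<in> ball 0 1"
    and eq: "joukowski_recip k z = joukowski_recip k w"
  have "1 + k * z\<^sup>2 \<noteq> 0" "1 + k * w\<^sup>2 \<noteq> 0"
    using joukowski_recip_denom_nonzero[OF assms] z w by auto
  with eq have "z * (1 + k * w\<^sup>2) = w * (1 + k * z\<^sup>2)"
    by (simp add: joukowski_recip_def frac_eq_eq)
  then have "(z - w) * (1 - k * z * w) = 0"
    by (simp add: algebra_simps power2_eq_square)
  moreover have "k * z * w \<noteq> 1"
    using cmod_mult_square_less_1[OF assms, of z w] z w by auto
  ultimately show "z = w"
    by auto
qed

section \<open>The image of the disk as a quartic region, for \<open>r < 1\<close>\<close>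

text \<open>This ties the sign of the gap to that of \<open>1 - N\<close>. The companion factor
  \<open>1 - r\<^sup>2 * N\<close> reflects the symmetry \<open>w \<mapsto> 1 / (r * w)\<close>,
  which preserves \<open>u\<close> and swaps the circles of radius 1 and \<open>1 / r\<close> when
  \<open>r > 0\<close>.\<close>

lemma quartic_gap_of_joukowski_recip:
  fixes r :: real and w :: complex
  defines "u \<equiv> joukowski_recip (of_real r) w"
    and "M \<equiv> (cmod (1 + of_real r * w\<^sup>2))\<^sup>2"
    and "N \<equiv> (cmod w)\<^sup>2"
  assumes "1 + of_real r * w\<^sup>2 \<noteq> 0"
  shows "M\<^sup>2 * quartic_gap r (Re u) (Im u) =
    (1 - N) * (1 - r\<^sup>2 * N) * ((Re w)\<^sup>2 * (1 - r)\<^sup>2 + (Im w)\<^sup>2 * (1 + r)\<^sup>2)"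
proof -
  define p q where "p = Re w" and "q = Im w"
  have w: "w = Complex p q"
    by (simp add: p_def q_def)
  have N: "N = p\<^sup>2 + q\<^sup>2"
    by (simp add: N_def p_def q_def cmod_power2)
  have M0: "M \<noteq> 0"
    using assms by simp
  have M: "M = (1 + r * (p\<^sup>2 - q\<^sup>2))\<^sup>2 + (2 * r * p * q)\<^sup>2"
    unfolding M_def cmod_power2 w by (simp add: power2_eq_square algebra_simps)
  have "u = w * cnj (1 + of_real r * w\<^sup>2) / of_real M"
    unfolding u_def joukowski_recip_def M_def by (subst complex_div_cnj) simp
  moreover have "w * cnj (1 + of_real r * w\<^sup>2) = Complex (p * (1 + r * N)) (q * (1 - r * N))"
    by (simp add: w N complex_eq_iff power2_eq_square algebra_simps)
  ultimately have re: "M * Re u = p * (1 + r * N)" and im: "M * Im u = q * (1 - r * N)"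
    using M0 by simp_all
  \<comment> \<open>Because the squared modulus of \<open>u\<close> is \<open>N / M\<close>, the
    factor \<open>M\<^sup>2\<close> clears the denominators even of the degree-four term.\<close>
  have nu: "M * ((Re u)\<^sup>2 + (Im u)\<^sup>2) = N"
  proof -
    have "M * (cmod u)\<^sup>2 = N"
      using M0 unfolding u_def joukowski_recip_def N_def M_def
      by (simp add: norm_divide power_divide)
    then show ?thesis
      by (simp add: cmod_power2)
  qed
  have "M\<^sup>2 * quartic_gap r (Re u) (Im u) =
      (M * Re u)\<^sup>2 * (1 - r)\<^sup>2 + (M * Im u)\<^sup>2 * (1 + r)\<^sup>2
      - (1 + r)\<^sup>2 * (1 - r)\<^sup>2 * (M * ((Re u)\<^sup>2 + (Im u)\<^sup>2))\<^sup>2"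
    unfolding quartic_gap_def by algebra
  also have "\<dots> = (1 - N) * (1 - r\<^sup>2 * N) * (p\<^sup>2 * (1 - r)\<^sup>2 + q\<^sup>2 * (1 + r)\<^sup>2)"
    unfolding re im nu N by algebra
  finally show ?thesis
    by (simp add: p_def q_def)
qed

lemma weighted_cmod_pos:
  fixes r :: real
  assumes "0 \<le> r" "r < 1" "w \<noteq> 0"
  shows "0 < (Re w)\<^sup>2 * (1 - r)\<^sup>2 + (Im w)\<^sup>2 * (1 + r)\<^sup>2"
proof -
  have "Re w \<noteq> 0 \<or> Im w \<noteq> 0"
    using assms(3) by (simp add: complex_eq_iff)
  then show ?thesis
    using assms(1,2) by (auto intro: add_pos_nonneg add_nonneg_pos)
qed

text \<open>Of the two solutions of \<open>r * u * w\<^sup>2 - w + u = 0\<close>, whose product is \<open>1 / r\<close>, this is the smaller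
  one; the formula avoids dividing by \<open>r * u\<close>.\<close>

lemma joukowski_recip_small_preimage:
  fixes r :: real
  assumes "0 \<le> r"
  obtains w where "1 + of_real r * w\<^sup>2 \<noteq> 0" "joukowski_recip (of_real r) w = u" "r * (cmod w)\<^sup>2 \<le> 1"
proof -
  define s where "s = csqrt (1 - 4 * of_real r * u\<^sup>2)"
  have s2: "s\<^sup>2 = 1 - 4 * of_real r * u\<^sup>2"
    by (simp add: s_def)
  \<comment> \<open>The principal branch of the root serves twice: it keeps \<open>1 + s\<close>
    away from 0 and makes \<open>1 - s\<close> no larger than \<open>1 + s\<close> in
    modulus.\<close>
  have Re_s: "0 \<le> Re s"
    using csqrt_principal[of "1 - 4 * of_real r * u\<^sup>2"] by (auto simp: s_def)
  have s1: "1 + s \<noteq> 0"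
    using Re_s by (auto simp: complex_eq_iff)
  define w where "w = 2 * u / (1 + s)"
  have rw: "of_real r * w\<^sup>2 = (1 - s) / (1 + s)"
  proof -
    have "of_real r * w\<^sup>2 = (4 * of_real r * u\<^sup>2) / (1 + s)\<^sup>2"
      by (simp add: w_def power_divide power_mult_distrib)
    also have "4 * of_real r * u\<^sup>2 = (1 - s) * (1 + s)"
      using s2 by (simp add: algebra_simps power2_eq_square)
    finally show ?thesis
      using s1 by (simp add: power2_eq_square)
  qed
  have den: "1 + of_real r * w\<^sup>2 = 2 / (1 + s)"
    unfolding rw using s1 by (simp add: field_simps)
  have "(cmod (1 - s))\<^sup>2 \<le> (cmod (1 + s))\<^sup>2"
    unfolding cmod_power2 using Re_s by (simp add: power2_eq_square algebra_simps)
  then have "cmod (1 - s) \<le> cmod (1 + s)"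
    by (rule power2_le_imp_le) simp
  then have "cmod (of_real r * w\<^sup>2) \<le> 1"
    using s1 by (simp add: rw norm_divide)
  then have "r * (cmod w)\<^sup>2 \<le> 1"
    using assms by (simp add: norm_mult norm_power)
  moreover have "joukowski_recip (of_real r) w = u"
    using s1 by (simp add: joukowski_recip_def den) (simp add: w_def)
  moreover have "1 + of_real r * w\<^sup>2 \<noteq> 0"
    using den s1 by simp
  ultimately show ?thesis
    using that by blast
qed

lemma joukowski_recip_image_iff:
  fixes r :: real
  assumes r: "0 \<le> r" "r < 1" and "u \<noteq> 0"
  shows "u \<in> joukowski_recip (of_real r) ` ball 0 1 \<longleftrightarrow> 0 < quartic_gap r (Re u) (Im u)"
proof -
  \<comment> \<open>For a preimage with \<open>r * cmod w < 1\<close> every factor except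
    \<open>1 - (cmod w)\<^sup>2\<close> is positive, so the gap decides whether \<open>w\<close> is
    in the disk. One direction below applies this to a given point of the disk, the other to the
    smaller root.\<close>
  have key: "cmod w < 1 \<longleftrightarrow> 0 < quartic_gap r (Re u) (Im u)"
    if nz: "1 + of_real r * w\<^sup>2 \<noteq> 0" and u: "joukowski_recip (of_real r) w = u"
      and small: "r\<^sup>2 * (cmod w)\<^sup>2 < 1" for w
  proof -
    have w0: "w \<noteq> 0"
      using u \<open>u \<noteq> 0\<close> by (auto simp: joukowski_recip_def)
    have M: "0 < ((cmod (1 + of_real r * w\<^sup>2))\<^sup>2)\<^sup>2"
      using nz by simp
    have "0 < quartic_gap r (Re u) (Im u) \<longleftrightarrow>
        0 < (1 - (cmod w)\<^sup>2) * (1 - r\<^sup>2 * (cmod w)\<^sup>2)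
              * ((Re w)\<^sup>2 * (1 - r)\<^sup>2 + (Im w)\<^sup>2 * (1 + r)\<^sup>2)"
      using quartic_gap_of_joukowski_recip[OF nz] M unfolding u
      by (metis zero_less_mult_pos mult_pos_pos)
    also have "\<dots> \<longleftrightarrow> 0 < 1 - (cmod w)\<^sup>2"
      using small weighted_cmod_pos[OF r w0] by (simp add: zero_less_mult_iff)
    also have "\<dots> \<longleftrightarrow> cmod w < 1"
      by (simp add: abs_square_less_1)
    finally show ?thesis
      by simp
  qed
  show ?thesis
  proof
    assume "u \<in> joukowski_recip (of_real r) ` ball 0 1"
    then obtain w where w: "cmod w < 1" "joukowski_recip (of_real r) w = u"
      by auto
    have "r * cmod w < 1"
      using mult_strict_mono[of r 1 "cmod w" 1] r w(1) by simp
    then have "r\<^sup>2 * (cmod w)\<^sup>2 < 1"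
      using r by (simp add: abs_square_less_1 abs_mult flip: power_mult_distrib)
    moreover have "1 + of_real r * w\<^sup>2 \<noteq> 0"
      using r w(1) by (intro joukowski_recip_denom_nonzero) auto
    ultimately show "0 < quartic_gap r (Re u) (Im u)"
      using key w by blast
  next
    assume pos: "0 < quartic_gap r (Re u) (Im u)"
    obtain w where w: "1 + of_real r * w\<^sup>2 \<noteq> 0" "joukowski_recip (of_real r) w = u"
        "r * (cmod w)\<^sup>2 \<le> 1"
      using joukowski_recip_small_preimage[OF r(1)] by blast
    \<comment> \<open>The smaller root gives only a weak bound; multiplying by \<open>r < 1\<close>
      makes it strict.\<close>
    have "r\<^sup>2 * (cmod w)\<^sup>2 \<le> r"
      using mult_left_mono[OF w(3) r(1)] by (simp add: power2_eq_square mult.assoc)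
    then have "cmod w < 1"
      using key w pos r by fastforce
    then show "u \<in> joukowski_recip (of_real r) ` ball 0 1"
      using w(2) by auto
  qed
qed

section \<open>Stability of the image under shrinking the real part\<close>

text \<open>As a function \<open>h\<close> of the squared abscissa the gap is a concave quadratic,
  nonnegative at 0 and positive at \<open>s\<close>, hence positive in between. The origin is
  excluded because the gap vanishes there.\<close>

lemma quartic_gap_shrink:
  assumes r: "0 \<le> r" "r < 1" and pos: "0 < quartic_gap r x y" and le: "\<bar>x'\<bar> \<le> \<bar>x\<bar>"
    and nz: "x' \<noteq> 0 \<or> y \<noteq> 0"
  shows "0 < quartic_gap r x' y"
proof -
  define A B s s' Y where "A = (1 + r)\<^sup>2" and "B = (1 - r)\<^sup>2" and "s = x\<^sup>2" and "s' = x'\<^sup>2" and "Y = y\<^sup>2"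
  define h where "h = (\<lambda>s. s * B + Y * A - A * B * (s + Y)\<^sup>2)"
  have hs: "0 < h s"
    using pos by (simp add: h_def quartic_gap_def A_def B_def s_def Y_def)
  have "0 < A" "0 < B" "B \<le> A"
    using r unfolding A_def B_def by (auto intro: power_mono)
  have "0 \<le> s'" "s' \<le> s" "0 \<le> Y"
    using le by (auto simp: s_def s'_def Y_def abs_le_square_iff)
  \<comment> \<open>This bound yields \<open>0 \<le> h 0\<close>. If it failed, the quartic term
    would outweigh \<open>s * B + Y * A\<close>, since \<open>B \<le> A\<close>.\<close>
  have BY: "B * Y < 1"
  proof (rule ccontr)
    assume "\<not> B * Y < 1"
    then have ge: "1 \<le> B * Y"
      by simp
    have "B * s \<le> A * s"
      using \<open>B \<le> A\<close> \<open>0 \<le> s'\<close> \<open>s' \<le> s\<close> by (intro mult_right_mono) auto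
    moreover have "A * (Y + 2 * s) \<le> A * (Y + 2 * s) * (B * Y)"
      using ge \<open>0 < A\<close> \<open>0 \<le> Y\<close> \<open>0 \<le> s'\<close> \<open>s' \<le> s\<close> mult_left_mono[of 1 "B * Y" "A * (Y + 2 * s)"] by simp
    moreover have "A * (Y + 2 * s) * (B * Y) + A * B * s\<^sup>2 = A * B * (s + Y)\<^sup>2"
      by algebra
    moreover have "0 \<le> A * B * s\<^sup>2" "0 \<le> A * s"
      using \<open>0 < A\<close> \<open>0 < B\<close> \<open>0 \<le> s'\<close> \<open>s' \<le> s\<close> by auto
    ultimately have "h s \<le> 0"
      unfolding h_def by (simp add: algebra_simps)
    with hs show False
      by simp
  qed
  have h0: "h 0 = Y * A * (1 - B * Y)"
    by (simp add: h_def algebra_simps power2_eq_square)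
  have "0 < h s'"
  proof (cases "s' = 0")
    case True
    then have "0 < Y"
      using nz by (auto simp: s'_def Y_def)
    then show ?thesis
      using True h0 BY \<open>0 < A\<close> by simp
  next
    case False
    then have "0 < s'"
      using \<open>0 \<le> s'\<close> by simp
    have "0 \<le> h 0"
      using h0 BY \<open>0 < A\<close> \<open>0 \<le> Y\<close> by simp
    \<comment> \<open>The chord inequality of concavity at 0, \<open>s'\<close>, \<open>s\<close>,
      as an identity; the last summand is the surplus due to the leading coefficient
      \<open>- A * B\<close>.\<close>
    have "s * h s' = s' * h s + (s - s') * h 0 + A * B * s * s' * (s - s')"
      unfolding h_def by algebra
    also have "\<dots> > 0"
      using \<open>0 < s'\<close> hs \<open>s' \<le> s\<close> \<open>0 \<le> h 0\<close> \<open>0 < A\<close> \<open>0 < B\<close>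
      by (intro add_pos_nonneg) auto
    finally show ?thesis
      using \<open>0 < s'\<close> \<open>s' \<le> s\<close> by (simp add: zero_less_mult_iff)
  qed
  then show ?thesis
    by (simp add: h_def quartic_gap_def A_def B_def s'_def Y_def)
qed

lemma joukowski_recip_image_shrink_less:
  fixes r :: real
  assumes r: "0 \<le> r" "r < 1" and u: "u \<in> joukowski_recip (of_real r) ` ball 0 1"
    and im: "Im v = Im u" and re: "\<bar>Re v\<bar> \<le> \<bar>Re u\<bar>"
  shows "v \<in> joukowski_recip (of_real r) ` ball 0 1"
proof (cases "v = 0")
  \<comment> \<open>The gap says nothing about the origin, which is the value at 0.\<close>
  case True
  then show ?thesis
    by (auto simp: joukowski_recip_def intro!: image_eqI[of _ _ 0])
next
  case False
  then have "u \<noteq> 0"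
    using im re by (auto simp: complex_eq_iff)
  then have "0 < quartic_gap r (Re u) (Im u)"
    using joukowski_recip_image_iff[OF r] u by blast
  then have "0 < quartic_gap r (Re v) (Im v)"
    using quartic_gap_shrink[OF r _ re, of "Im u"] False im by (auto simp: complex_eq_iff)
  then show ?thesis
    using joukowski_recip_image_iff[OF r False] by blast
qed

text \<open>A real \<open>c\<close> between 0 and 1 serves to lower the parameter below 1;
  \<open>c = cis \<gamma>\<close> serves to rotate a complex coefficient onto the real axis.\<close>

lemma joukowski_recip_scale:
  "c * joukowski_recip (k * c\<^sup>2) z = joukowski_recip k (c * z)"
  by (simp add: joukowski_recip_def power_mult_distrib mult.assoc)

text \<open>At \<open>r = 1\<close> the ellipse degenerates to a segment and the gap no longer
  describes the image. A radius \<open>\<rho>\<close> between \<open>cmod w\<close> and 1 places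
  \<open>u / \<rho>\<close> in the image for the parameter \<open>r * \<rho>\<^sup>2 < 1\<close>;
  the preimage found there for \<open>v / \<rho>\<close> is scaled back by
  \<open>\<rho>\<close>.\<close>

lemma joukowski_recip_image_shrink:
  fixes r :: real
  assumes r: "0 \<le> r" "r \<le> 1" and u: "u \<in> joukowski_recip (of_real r) ` ball 0 1"
    and im: "Im v = Im u" and re: "\<bar>Re v\<bar> \<le> \<bar>Re u\<bar>"
  shows "v \<in> joukowski_recip (of_real r) ` ball 0 1"
proof -
  obtain w where w: "cmod w < 1" and uw: "u = joukowski_recip (of_real r) w"
    using u by auto
  obtain \<rho> where \<rho>: "cmod w < \<rho>" "\<rho> < 1"
    using dense[OF w] by blast
  have \<rho>0: "0 < \<rho>"
    using \<rho> norm_ge_zero[of w] by linarith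
  have "\<rho>\<^sup>2 < 1"
    using \<rho> \<rho>0 by (simp add: abs_square_less_1)
  then have r': "0 \<le> r * \<rho>\<^sup>2" "r * \<rho>\<^sup>2 < 1"
    using r mult_left_le_one_le[of "\<rho>\<^sup>2" r] by auto
  have scale: "of_real \<rho> * joukowski_recip (of_real (r * \<rho>\<^sup>2)) z =
      joukowski_recip (of_real r) (of_real \<rho> * z)" for z
    using joukowski_recip_scale[of "of_real \<rho>" "of_real r" z] by simp
  have "u / of_real \<rho> = joukowski_recip (of_real (r * \<rho>\<^sup>2)) (w / of_real \<rho>)"
    using scale[of "w / of_real \<rho>"] \<rho>0 uw by (simp add: field_simps)
  moreover have "w / of_real \<rho> \<in> ball 0 1"
    using \<rho> \<rho>0 by (simp add: norm_divide)
  ultimately have "u / of_real \<rho> \<in> joukowski_recip (of_real (r * \<rho>\<^sup>2)) ` ball 0 1"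
    by blast
  moreover have "Im (v / of_real \<rho>) = Im (u / of_real \<rho>)"
    using im by simp
  moreover have "\<bar>Re (v / of_real \<rho>)\<bar> \<le> \<bar>Re (u / of_real \<rho>)\<bar>"
    using re \<rho>0 by (simp add: divide_right_mono)
  ultimately have "v / of_real \<rho> \<in> joukowski_recip (of_real (r * \<rho>\<^sup>2)) ` ball 0 1"
    by (rule joukowski_recip_image_shrink_less[OF r'])
  then obtain z where z: "cmod z < 1" "v / of_real \<rho> = joukowski_recip (of_real (r * \<rho>\<^sup>2)) z"
    by auto
  have "v = joukowski_recip (of_real r) (of_real \<rho> * z)"
    using scale[of z] z(2) \<rho>0 by (simp add: field_simps)
  moreover have "cmod (of_real \<rho> * z) < 1"
    using z(1) \<rho> \<rho>0 mult_strict_mono[of \<rho> 1 "cmod z" 1] by (simp add: norm_mult)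
  ultimately show ?thesis
    by auto
qed

section \<open>Rotation to an arbitrary direction\<close>

text \<open>Turning by \<open>- \<gamma>\<close> makes the line horizontal. A point between two
  points of \<open>G\<close> on it is no farther from the imaginary axis than one of them, so the
  parameters hitting \<open>G\<close> form an interval.\<close>

lemma connected_inter_line_in_direction:
  assumes shrink: "\<And>u v. u \<in> G \<Longrightarrow> Im v = Im u \<Longrightarrow> \<bar>Re v\<bar> \<le> \<bar>Re u\<bar> \<Longrightarrow> v \<in> G"
  shows "connected ((*) (cis \<gamma>) ` G \<inter> line_in_direction \<gamma> p)"
proof -
  define q where "q = cis (- \<gamma>) * p"
  have p: "p = cis \<gamma> * q"
    by (simp add: q_def cis_mult flip: mult.assoc)
  define T where "T = {t::real. q + of_real t \<in> G}"
  have "is_interval T"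
    unfolding is_interval_1
  proof (intro ballI allI impI)
    fix s t x assume st: "s \<in> T" "t \<in> T" and x: "s \<le> x \<and> x \<le> t"
    then consider "\<bar>Re q + x\<bar> \<le> \<bar>Re q + s\<bar>" | "\<bar>Re q + x\<bar> \<le> \<bar>Re q + t\<bar>"
      by linarith
    then show "x \<in> T"
      using st shrink[of "q + of_real s" "q + of_real x"] shrink[of "q + of_real t" "q + of_real x"]
      by cases (auto simp: T_def)
  qed
  then have "connected ((\<lambda>t. cis \<gamma> * (q + of_real t)) ` T)"
    by (intro connected_continuous_image continuous_intros) (simp add: is_interval_connected)
  moreover have "(*) (cis \<gamma>) ` G \<inter> line_in_direction \<gamma> p = (\<lambda>t. cis \<gamma> * (q + of_real t)) ` T"
  proof -
    have "line_in_direction \<gamma> p = (\<lambda>t. cis \<gamma> * (q + of_real t)) ` UNIV"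
      by (auto simp: line_in_direction_def p algebra_simps)
    moreover have "cis \<gamma> * u \<in> (*) (cis \<gamma>) ` G \<longleftrightarrow> u \<in> G" for u
      by auto
    ultimately show ?thesis
      unfolding T_def by auto
  qed
  ultimately show ?thesis
    by simp
qed

lemma convex_in_direction_cong:
  assumes "\<And>z. z \<in> ball 0 1 \<Longrightarrow> f z = g z" "convex_in_direction \<gamma> g"
  shows "convex_in_direction \<gamma> f"
proof -
  have "f holomorphic_on ball 0 1 \<longleftrightarrow> g holomorphic_on ball 0 1"
    using assms(1) by (intro holomorphic_cong) auto
  moreover have "inj_on f (ball 0 1) \<longleftrightarrow> inj_on g (ball 0 1)"
    using assms(1) by (rule inj_on_cong)
  moreover have "f ` ball 0 1 = g ` ball 0 1"
    using assms(1) by (intro image_cong) auto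
  ultimately show ?thesis
    using assms(2) by (simp add: convex_in_direction_def)
qed

lemma joukowski_recip_convex_in_direction:
  assumes r: "0 \<le> r" "r \<le> 1"
  shows "convex_in_direction \<gamma> (joukowski_recip (of_real r * cis (- 2 * \<gamma>)))"
proof -
  define k where "k = of_real r * cis (- 2 * \<gamma>)"
  have k: "cmod k \<le> 1"
    using r by (simp add: k_def norm_mult)
  note hol = joukowski_recip_holomorphic[OF k] and inj = joukowski_recip_inj[OF k]
  \<comment> \<open>The argument \<open>- 2 * \<gamma>\<close> of \<open>k\<close> is chosen for
    this: rotating the variable by \<open>\<gamma>\<close> makes the coefficient real.\<close>
  have "k * (cis \<gamma>)\<^sup>2 = of_real r"
    by (simp add: k_def power2_eq_square cis_mult mult.assoc)
  then have scale: "joukowski_recip k (cis \<gamma> * z) = cis \<gamma> * joukowski_recip (of_real r) z" for z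
    using joukowski_recip_scale[of "cis \<gamma>" k z] by simp
  have "(*) (cis \<gamma>) ` ball 0 1 = ball 0 1"
  proof (intro equalityI subsetI)
    fix z :: complex assume "z \<in> ball 0 1"
    then show "z \<in> (*) (cis \<gamma>) ` ball 0 1"
      by (intro image_eqI[of _ _ "cis (- \<gamma>) * z"]) (auto simp: norm_mult cis_mult simp flip: mult.assoc)
  qed (auto simp: norm_mult)
  then have "joukowski_recip k ` ball 0 1 = joukowski_recip k ` (*) (cis \<gamma>) ` ball 0 1"
    by simp
  also have "\<dots> = (*) (cis \<gamma>) ` joukowski_recip (of_real r) ` ball 0 1"
    by (simp add: image_image scale)
  finally have image: "joukowski_recip k ` ball 0 1 =
      (*) (cis \<gamma>) ` joukowski_recip (of_real r) ` ball 0 1" .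
  have "open (joukowski_recip k ` ball 0 1)"
    using open_mapping_thm3[OF hol _ inj] by simp
  moreover have "connected (joukowski_recip k ` ball 0 1)"
    using hol by (intro connected_continuous_image holomorphic_on_imp_continuous_on) auto
  moreover have "connected (joukowski_recip k ` ball 0 1 \<inter> line_in_direction \<gamma> p)" for p
    unfolding image
    by (intro connected_inter_line_in_direction) (rule joukowski_recip_image_shrink[OF r])
  ultimately show ?thesis
    using hol inj
    unfolding convex_in_direction_def domain_convex_in_direction_def k_def[symmetric] by auto
qed

theorem theorem2:
  fixes lam \<theta> :: real and a :: complex and f \<omega>\<^sub>1 :: "complex \<Rightarrow> complex"
  assumes "0 < lam" and "lam \<le> 1"
    and "f \<in> class_U2 lam"
    and "\<And>z. z \<in> ball 0 1 \<Longrightarrow> z_over f z = 1 + of_real lam * \<omega>\<^sub>1 z"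
    and "\<And>z. z \<in> ball 0 1 \<Longrightarrow> \<omega>\<^sub>1 z = a * z\<^sup>2"
    and "cmod a \<le> 1"
    and "is_Arg a \<theta>"
  shows "convex_in_direction (2 * pi - \<theta> / 2) f"
proof (rule convex_in_direction_cong)
  define k where "k = of_real (lam * cmod a) * cis (- 2 * (2 * pi - \<theta> / 2))"
  \<comment> \<open>The angle equals \<open>\<theta> - 4 * pi\<close>, two full turns away from
    \<open>\<theta>\<close>.\<close>
  have "cis (- 2 * (2 * pi - \<theta> / 2)) = cis \<theta>"
    by (simp add: complex_eq_iff cos_diff sin_diff algebra_simps)
  moreover have "a = of_real (cmod a) * cis \<theta>"
    using assms(7) by (simp add: is_Arg_def cis_conv_exp)
  ultimately have k: "k = of_real lam * a"
    unfolding k_def by (metis of_real_mult mult.assoc)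
  show "f z = joukowski_recip k z" if z: "z \<in> ball 0 1" for z
  proof (cases "z = 0")
    \<comment> \<open>The filled-in value of \<open>z_over\<close> carries no information on
      \<open>f 0\<close>; the normalisation of the class supplies it.\<close>
    case True
    then show ?thesis
      using assms(3) by (simp add: class_U2_def class_U_def class_A_def joukowski_recip_def)
  next
    case False
    then have "f z \<noteq> 0"
      using assms(3) z by (auto simp: class_U2_def class_U_def)
    moreover have "z / f z = 1 + k * z\<^sup>2"
      using assms(4,5)[OF z] False by (simp add: z_over_def k)
    ultimately show ?thesis
      using False by (simp add: joukowski_recip_def flip: \<open>z / f z = 1 + k * z\<^sup>2\<close>)
  qed
  show "convex_in_direction (2 * pi - \<theta> / 2) (joukowski_recip k)"
    unfolding k_def using assms(1,2,6)
    by (intro joukowski_recip_convex_in_direction) (auto intro: mult_le_one)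
qed

end
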